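(* Let $A$ and $B$ be skew braces and let $\sigma:(B,\cdot)\to\mathrm{Aut}(A,\cdot,\circ)$ and $\tau:(B,\circ)\to\mathrm{Aut}(A,\cdot,\circ)$ be group homomorphisms. Consider on $A\times B$ the additive structure of the semidirect product $(A,\cdot)\rtimes_\sigma(B,\cdot)$ and the multiplicative structure of the semidirect product $(A,\circ)\rtimes_\tau(B,\circ)$, that is, $$(a,b)\cdot(a',b')=(a\cdot\sigma(b)(a'),\,b\cdot b'),\qquad (a,b)\circ(a',b')=(a\circ\tau(b)(a'),\,b\circ b').$$ Assume that for every $a\in A$ and all $b_1,b_2\in B$ the following equality of maps $A\to A$ holds: $$\sigma\big((b_1\circ b_2)\cdot b_1^{-1}\big)\,\lambda_a=\lambda_a\,\tau(b_1)\,\sigma(b_2)\,\tau(b_1)^{-1}.$$ Then $(A\times B,\cdot,\circ)$ is a skew brace.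
   Context: A skew brace is a triple $(B,\cdot,\circ)$ where $(B,\cdot)$ and $(B,\circ)$ are groups on the same set and $a\circ(b\cdot c)=(a\circ b)\cdot a^{-1}\cdot(a\circ c)$ for all $a,b,c\in B$, with $a^{-1}$ the inverse of $a$ in $(B,\cdot)$. For a skew brace $A$ and $a\in A$, $\lambda_a:A\to A$ is the map $\lambda_a(x)=a^{-1}\cdot(a\circ x)$. $\mathrm{Aut}(A,\cdot,\circ)$ is the group of bijections of $A$ that are homomorphisms for both operations. Juxtaposition of maps denotes composition. *)

theory Defs
  imports "HOL-Algebra.Bij"
begin

text \<open>
  A skew brace \<open>(B, \<cdot>, \<circ>)\<close> is given by two group structures \<open>G = (B, \<cdot>)\<close> and
  \<open>H = (B, \<circ>)\<close> with the same carrier. No commutativity of \<open>\<cdot>\<close> is assumed.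
\<close>

locale skew_brace = add: group G + circ: group H
  for G :: "('a, 'm) monoid_scheme" and H :: "('a, 'n) monoid_scheme" +
  assumes carrier_eq: "carrier H = carrier G"
    and brace_compat:
      "\<lbrakk>a \<in> carrier G; b \<in> carrier G; c \<in> carrier G\<rbrakk> \<Longrightarrow>
        a \<otimes>\<^bsub>H\<^esub> (b \<otimes>\<^bsub>G\<^esub> c) = (a \<otimes>\<^bsub>H\<^esub> b) \<otimes>\<^bsub>G\<^esub> inv\<^bsub>G\<^esub> a \<otimes>\<^bsub>G\<^esub> (a \<otimes>\<^bsub>H\<^esub> c)"

definition brace_lambda ::
    "('a, 'm) monoid_scheme \<Rightarrow> ('a, 'n) monoid_scheme \<Rightarrow> 'a \<Rightarrow> 'a \<Rightarrow> 'a"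
  where "brace_lambda G H a = (\<lambda>x \<in> carrier G. inv\<^bsub>G\<^esub> a \<otimes>\<^bsub>G\<^esub> (a \<otimes>\<^bsub>H\<^esub> x))"

text \<open>
  As for \<^const>\<open>AutoGroup\<close>, automorphisms are extensional functions on the carrier, so that
  equality in the group is equality of maps on the carrier.
\<close>

definition brace_AutoGroup ::
    "('a, 'm) monoid_scheme \<Rightarrow> ('a, 'n) monoid_scheme \<Rightarrow> ('a \<Rightarrow> 'a) monoid"
  where "brace_AutoGroup G H = BijGroup (carrier G) \<lparr>carrier := auto G \<inter> auto H\<rparr>"

definition semidirect_product ::
    "('a, 'm) monoid_scheme \<Rightarrow> ('b, 'n) monoid_scheme \<Rightarrow> ('b \<Rightarrow> 'a \<Rightarrow> 'a) \<Rightarrow> ('a \<times> 'b) monoid"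
  where "semidirect_product G K \<phi> =
    \<lparr>carrier = carrier G \<times> carrier K,
     mult = (\<lambda>(a, b) (a', b'). (a \<otimes>\<^bsub>G\<^esub> \<phi> b a', b \<otimes>\<^bsub>K\<^esub> b')),
     one = (\<one>\<^bsub>G\<^esub>, \<one>\<^bsub>K\<^esub>)\<rparr>"

lemma (in skew_brace) group_brace_AutoGroup: "group (brace_AutoGroup G H)"
proof -
  have "subgroup (auto G \<inter> auto H) (BijGroup (carrier G))"
    using group.subgroups_Inter_pair[OF group_BijGroup] add.subgroup_auto circ.subgroup_auto
    by (simp add: carrier_eq)
  then show ?thesis
    unfolding brace_AutoGroup_def
    by (simp add: subgroup.subgroup_is_group group_BijGroup)
qed

end

theory Submission
  imports Defs
begin

text \<open>Both operations on the product set are semidirect products of groups, because a brace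
  automorphism is an automorphism of either group structure (\<open>hom_brace_AutoGroup\<close>,
  \<open>group_semidirect_product\<close>). What remains is brace compatibility for (a,b), (a',b'),
  (a'',b''). Its second component is compatibility in B. For the first, let c = (b \<circ> b')
  \<cdot> b^-1. Additivity of \<tau>(b) and compatibility in A turn the left side into the product
  of a \<circ> \<tau>(b)(a') and \<lambda>_a \<tau>(b) \<sigma>(b') (a''). By the formula for
  additive inverses (\<open>inv_semidirect_product\<close>), the right side is the product of the
  same first factor and \<sigma>(c) \<lambda>_a \<tau>(b) (a''). The two second factors agree by the
  assumed identity, composed on the right with \<tau>(b).\<close>

lemma action_AutoGroup:
  assumes "group K" and "\<phi> \<in> hom K (AutoGroup G)"
  shows action_hom: "b \<in> carrier K \<Longrightarrow> \<phi> b \<in> hom G G"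
    and action_closed: "\<lbrakk>b \<in> carrier K; x \<in> carrier G\<rbrakk> \<Longrightarrow> \<phi> b x \<in> carrier G"
    and action_distrib: "\<lbrakk>b \<in> carrier K; x \<in> carrier G; y \<in> carrier G\<rbrakk> \<Longrightarrow>
      \<phi> b (x \<otimes>\<^bsub>G\<^esub> y) = \<phi> b x \<otimes>\<^bsub>G\<^esub> \<phi> b y"
    and action_mult: "\<lbrakk>b \<in> carrier K; c \<in> carrier K; x \<in> carrier G\<rbrakk> \<Longrightarrow>
      \<phi> (b \<otimes>\<^bsub>K\<^esub> c) x = \<phi> b (\<phi> c x)"
    and action_one: "x \<in> carrier G \<Longrightarrow> \<phi> \<one>\<^bsub>K\<^esub> x = x"
proof -
  interpret K: group K by fact
  have auto: "\<phi> b \<in> hom G G" "\<phi> b \<in> Bij (carrier G)" if "b \<in> carrier K" for b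
    using hom_in_carrier[OF assms(2) that] by (auto simp: AutoGroup_def auto_def)
  show hom: "\<phi> b \<in> hom G G" if "b \<in> carrier K" for b
    using auto that by blast
  show closed: "\<phi> b x \<in> carrier G" if "b \<in> carrier K" "x \<in> carrier G" for b x
    using hom_in_carrier hom that by metis
  show "\<phi> b (x \<otimes>\<^bsub>G\<^esub> y) = \<phi> b x \<otimes>\<^bsub>G\<^esub> \<phi> b y"
    if "b \<in> carrier K" "x \<in> carrier G" "y \<in> carrier G" for b x y
    using hom_mult hom that by metis
  show mult: "\<phi> (b \<otimes>\<^bsub>K\<^esub> c) x = \<phi> b (\<phi> c x)"
    if "b \<in> carrier K" "c \<in> carrier K" "x \<in> carrier G" for b c x
    using hom_mult[OF assms(2) that(1,2)] auto that
    by (simp add: AutoGroup_def BijGroup_def compose_def)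
  \<comment> \<open>For arbitrary \<open>G\<close>, \<open>AutoGroup G\<close> is not known to be a
    group, so preservation of units cannot be quoted. Instead, the image of the unit is an
    idempotent map that is injective on the carrier, hence the identity there.\<close>
  show "\<phi> \<one>\<^bsub>K\<^esub> x = x" if x: "x \<in> carrier G" for x
  proof -
    have "inj_on (\<phi> \<one>\<^bsub>K\<^esub>) (carrier G)"
      using auto(2) by (simp add: Bij_def bij_betw_def)
    moreover have "\<phi> \<one>\<^bsub>K\<^esub> (\<phi> \<one>\<^bsub>K\<^esub> x) = \<phi> \<one>\<^bsub>K\<^esub> x"
      using mult[OF K.one_closed K.one_closed x] by simp
    ultimately show ?thesis
      using closed x by (auto dest: inj_onD)
  qed
qed

lemma carrier_semidirect_product [simp]:
  "carrier (semidirect_product G K \<phi>) = carrier G \<times> carrier K"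
  by (simp add: semidirect_product_def)

lemma mult_semidirect_product [simp]:
  "(a, b) \<otimes>\<^bsub>semidirect_product G K \<phi>\<^esub> (a', b') = (a \<otimes>\<^bsub>G\<^esub> \<phi> b a', b \<otimes>\<^bsub>K\<^esub> b')"
  by (simp add: semidirect_product_def)

lemma one_semidirect_product [simp]:
  "\<one>\<^bsub>semidirect_product G K \<phi>\<^esub> = (\<one>\<^bsub>G\<^esub>, \<one>\<^bsub>K\<^esub>)"
  by (simp add: semidirect_product_def)

lemma semidirect_product_l_inv:
  assumes "group G" and "group K" and "\<phi> \<in> hom K (AutoGroup G)"
    and "a \<in> carrier G" and "b \<in> carrier K"
  shows "(\<phi> (inv\<^bsub>K\<^esub> b) (inv\<^bsub>G\<^esub> a), inv\<^bsub>K\<^esub> b) \<otimes>\<^bsub>semidirect_product G K \<phi>\<^esub> (a, b)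
    = \<one>\<^bsub>semidirect_product G K \<phi>\<^esub>"
proof -
  interpret G: group G by fact
  interpret K: group K by fact
  have "\<phi> (inv\<^bsub>K\<^esub> b) (inv\<^bsub>G\<^esub> a) \<otimes>\<^bsub>G\<^esub> \<phi> (inv\<^bsub>K\<^esub> b) a = \<phi> (inv\<^bsub>K\<^esub> b) \<one>\<^bsub>G\<^esub>"
    using action_distrib[OF assms(2,3), of "inv\<^bsub>K\<^esub> b" "inv\<^bsub>G\<^esub> a" a] assms(4,5) by simp
  also have "\<dots> = \<one>\<^bsub>G\<^esub>"
    using hom_one[OF action_hom[OF assms(2,3)] assms(1,1)] assms(5) by simp
  finally show ?thesis
    using assms(5) by simp
qed

text \<open>Associativity holds because either bracketing has first component a \<cdot>
  \<phi>(b)(a') \<cdot> \<phi>(bb')(a''). For inverses, \<open>groupI\<close> asks only for left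
  ones.\<close>

lemma group_semidirect_product:
  assumes "group G" and "group K" and "\<phi> \<in> hom K (AutoGroup G)"
  shows "group (semidirect_product G K \<phi>)"
proof -
  interpret G: group G by fact
  interpret K: group K by fact
  note [simp] = action_closed[OF assms(2,3)] action_distrib[OF assms(2,3)]
    action_mult[OF assms(2,3)] action_one[OF assms(2,3)]
  show ?thesis
  proof (rule groupI)
    fix x assume "x \<in> carrier (semidirect_product G K \<phi>)"
    then obtain a b where x: "x = (a, b)" "a \<in> carrier G" "b \<in> carrier K"
      by auto
    then have "(\<phi> (inv\<^bsub>K\<^esub> b) (inv\<^bsub>G\<^esub> a), inv\<^bsub>K\<^esub> b) \<in> carrier (semidirect_product G K \<phi>)"
      by simp
    then show "\<exists>y \<in> carrier (semidirect_product G K \<phi>).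
        y \<otimes>\<^bsub>semidirect_product G K \<phi>\<^esub> x = \<one>\<^bsub>semidirect_product G K \<phi>\<^esub>"
      using semidirect_product_l_inv[OF assms x(2,3)] x(1) by blast
  qed (auto simp: G.m_assoc K.m_assoc)
qed

lemma inv_semidirect_product:
  assumes "group G" and "group K" and "\<phi> \<in> hom K (AutoGroup G)"
    and "a \<in> carrier G" and "b \<in> carrier K"
  shows "inv\<^bsub>semidirect_product G K \<phi>\<^esub> (a, b) = (\<phi> (inv\<^bsub>K\<^esub> b) (inv\<^bsub>G\<^esub> a), inv\<^bsub>K\<^esub> b)"
  using group.inv_equality[OF group_semidirect_product[OF assms(1-3)]
      semidirect_product_l_inv[OF assms]] assms action_closed[OF assms(2,3)]
  by (simp add: group.inv_closed)

context skew_brace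
begin

lemma hom_brace_AutoGroup:
  assumes "\<phi> \<in> hom K (brace_AutoGroup G H)"
  shows "\<phi> \<in> hom K (AutoGroup G)" and "\<phi> \<in> hom K (AutoGroup H)"
  using assms
  by (auto simp: hom_def brace_AutoGroup_def AutoGroup_def carrier_eq)

text \<open>The unit of this group is the identity restricted to the carrier, so the group inverse
  undoes f at every point of the carrier. This serves to cancel the inverse of \<tau>(b) in the
  assumed identity.\<close>

lemma inv_brace_AutoGroup_apply:
  assumes "f \<in> carrier (brace_AutoGroup G H)" and "x \<in> carrier G"
  shows "(inv\<^bsub>brace_AutoGroup G H\<^esub> f) (f x) = x"
proof -
  interpret Aut: group "brace_AutoGroup G H"
    by (rule group_brace_AutoGroup)
  have "f \<in> Bij (carrier G)" "inv\<^bsub>brace_AutoGroup G H\<^esub> f \<in> Bij (carrier G)"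
    using assms(1) Aut.inv_closed[OF assms(1)]
    by (auto simp: brace_AutoGroup_def auto_def)
  then have "compose (carrier G) (inv\<^bsub>brace_AutoGroup G H\<^esub> f) f = (\<lambda>x \<in> carrier G. x)"
    using Aut.l_inv[OF assms(1)] by (simp add: brace_AutoGroup_def BijGroup_def)
  then show ?thesis
    using assms(2) compose_eq by (metis restrict_apply')
qed

end

theorem proposition2p1:
  fixes A_dot A_circ :: "'a monoid" and B_dot B_circ :: "'b monoid"
    and \<sigma> \<tau> :: "'b \<Rightarrow> 'a \<Rightarrow> 'a"
  assumes "skew_brace A_dot A_circ" and "skew_brace B_dot B_circ"
    and "\<sigma> \<in> hom B_dot (brace_AutoGroup A_dot A_circ)"
    and "\<tau> \<in> hom B_circ (brace_AutoGroup A_dot A_circ)"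
    and "\<And>a b\<^sub>1 b\<^sub>2. \<lbrakk>a \<in> carrier A_dot; b\<^sub>1 \<in> carrier B_dot; b\<^sub>2 \<in> carrier B_dot\<rbrakk> \<Longrightarrow>
      compose (carrier A_dot)
        (\<sigma> ((b\<^sub>1 \<otimes>\<^bsub>B_circ\<^esub> b\<^sub>2) \<otimes>\<^bsub>B_dot\<^esub> inv\<^bsub>B_dot\<^esub> b\<^sub>1)) (brace_lambda A_dot A_circ a)
      = compose (carrier A_dot) (brace_lambda A_dot A_circ a)
          (compose (carrier A_dot) (\<tau> b\<^sub>1)
            (compose (carrier A_dot) (\<sigma> b\<^sub>2) (inv\<^bsub>brace_AutoGroup A_dot A_circ\<^esub> (\<tau> b\<^sub>1))))"
  shows "skew_brace (semidirect_product A_dot B_dot \<sigma>) (semidirect_product A_circ B_circ \<tau>)"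
proof -
  interpret A: skew_brace A_dot A_circ by fact
  interpret B: skew_brace B_dot B_circ by fact
  note \<sigma> = A.hom_brace_AutoGroup(1)[OF assms(3)]
  \<comment> \<open>Both versions are used: the multiplicative one builds the second semidirect
    product, the additive one lets \<tau>(b) pass through \<open>A_dot\<close> products.\<close>
  note \<tau> = A.hom_brace_AutoGroup[OF assms(4)]
  note [simp] = action_closed[OF B.add.is_group \<sigma>] action_closed[OF B.circ.is_group \<tau>(1)]
    A.carrier_eq B.carrier_eq
  \<comment> \<open>The simplifier rewrites \<open>carrier A_circ\<close> to
    \<open>carrier A_dot\<close>, so closure is restated in that form.\<close>
  have circ_closed [simp]: "a \<otimes>\<^bsub>A_circ\<^esub> a' \<in> carrier A_dot"
    if "a \<in> carrier A_dot" "a' \<in> carrier A_dot" for a a'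
    using A.circ.m_closed that by simp
  have circ_closed' [simp]: "b \<otimes>\<^bsub>B_circ\<^esub> b' \<in> carrier B_dot"
    if "b \<in> carrier B_dot" "b' \<in> carrier B_dot" for b b'
    using B.circ.m_closed that by simp
  \<comment> \<open>The assumed equality of maps is evaluated at \<open>\<tau> b\<^sub>1 x\<close>
    rather than at \<open>x\<close>, which removes the inverse of \<open>\<tau> b\<^sub>1\<close> on
    the right.\<close>
  have lambda: "\<sigma> (b\<^sub>1 \<otimes>\<^bsub>B_circ\<^esub> b\<^sub>2 \<otimes>\<^bsub>B_dot\<^esub> inv\<^bsub>B_dot\<^esub> b\<^sub>1)
        (inv\<^bsub>A_dot\<^esub> a \<otimes>\<^bsub>A_dot\<^esub> (a \<otimes>\<^bsub>A_circ\<^esub> \<tau> b\<^sub>1 x))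
      = inv\<^bsub>A_dot\<^esub> a \<otimes>\<^bsub>A_dot\<^esub> (a \<otimes>\<^bsub>A_circ\<^esub> \<tau> b\<^sub>1 (\<sigma> b\<^sub>2 x))"
    if "a \<in> carrier A_dot" "b\<^sub>1 \<in> carrier B_dot" "b\<^sub>2 \<in> carrier B_dot" "x \<in> carrier A_dot"
    for a b\<^sub>1 b\<^sub>2 x
  proof -
    have "\<tau> b\<^sub>1 \<in> carrier (brace_AutoGroup A_dot A_circ)"
      using hom_in_carrier[OF assms(4)] that by simp
    from A.inv_brace_AutoGroup_apply[OF this that(4)] show ?thesis
      using fun_cong[OF assms(5)[OF that(1-3)], of "\<tau> b\<^sub>1 x"] that
      by (simp add: compose_eq brace_lambda_def)
  qed
  show ?thesis
  proof (intro skew_brace.intro skew_brace_axioms.intro)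
    show "group (semidirect_product A_dot B_dot \<sigma>)"
      by (intro group_semidirect_product \<sigma> A.add.is_group B.add.is_group)
    show "group (semidirect_product A_circ B_circ \<tau>)"
      by (intro group_semidirect_product \<tau> A.circ.is_group B.circ.is_group)
  next
    show "carrier (semidirect_product A_circ B_circ \<tau>) = carrier (semidirect_product A_dot B_dot \<sigma>)"
      by simp
  next
    fix x y z
    assume "x \<in> carrier (semidirect_product A_dot B_dot \<sigma>)"
      "y \<in> carrier (semidirect_product A_dot B_dot \<sigma>)"
      "z \<in> carrier (semidirect_product A_dot B_dot \<sigma>)"
    then obtain a b a' b' a'' b'' where xyz: "x = (a, b)" "y = (a', b')" "z = (a'', b'')"
      and a: "a \<in> carrier A_dot" "a' \<in> carrier A_dot" "a'' \<in> carrier A_dot"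
      and b: "b \<in> carrier B_dot" "b' \<in> carrier B_dot" "b'' \<in> carrier B_dot"
      by auto
    let ?c = "b \<otimes>\<^bsub>B_circ\<^esub> b' \<otimes>\<^bsub>B_dot\<^esub> inv\<^bsub>B_dot\<^esub> b"
    have "a \<otimes>\<^bsub>A_circ\<^esub> \<tau> b (a' \<otimes>\<^bsub>A_dot\<^esub> \<sigma> b' a'')
        = a \<otimes>\<^bsub>A_circ\<^esub> (\<tau> b a' \<otimes>\<^bsub>A_dot\<^esub> \<tau> b (\<sigma> b' a''))"
      using a b by (simp add: action_distrib[OF B.circ.is_group \<tau>(1)])
    also have "\<dots> = (a \<otimes>\<^bsub>A_circ\<^esub> \<tau> b a') \<otimes>\<^bsub>A_dot\<^esub>
        (inv\<^bsub>A_dot\<^esub> a \<otimes>\<^bsub>A_dot\<^esub> (a \<otimes>\<^bsub>A_circ\<^esub> \<tau> b (\<sigma> b' a'')))"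
      using a b by (simp add: A.brace_compat A.add.m_assoc)
    also have "\<dots> = (a \<otimes>\<^bsub>A_circ\<^esub> \<tau> b a') \<otimes>\<^bsub>A_dot\<^esub>
        \<sigma> ?c (inv\<^bsub>A_dot\<^esub> a \<otimes>\<^bsub>A_dot\<^esub> (a \<otimes>\<^bsub>A_circ\<^esub> \<tau> b a''))"
      using a b by (simp add: lambda)
    \<comment> \<open>Since c = (b \<circ> b') \<cdot> b^-1, the map \<sigma>(c) splits as
      \<sigma>(b \<circ> b') \<sigma>(b^-1). It is split only on the factor a^-1, to expose
      \<sigma>(b^-1)(a^-1), the first component of the additive inverse of (a,b). On the last factor
      \<sigma>(c) stays whole, as c is the second component of the partial product to its
      left.\<close>
    also have "\<dots> = (a \<otimes>\<^bsub>A_circ\<^esub> \<tau> b a') \<otimes>\<^bsub>A_dot\<^esub>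
        \<sigma> (b \<otimes>\<^bsub>B_circ\<^esub> b') (\<sigma> (inv\<^bsub>B_dot\<^esub> b) (inv\<^bsub>A_dot\<^esub> a)) \<otimes>\<^bsub>A_dot\<^esub>
        \<sigma> ?c (a \<otimes>\<^bsub>A_circ\<^esub> \<tau> b a'')"
      using a b
      by (simp add: action_distrib[OF B.add.is_group \<sigma>] action_mult[OF B.add.is_group \<sigma>]
          A.add.m_assoc)
    finally show "x \<otimes>\<^bsub>semidirect_product A_circ B_circ \<tau>\<^esub> (y \<otimes>\<^bsub>semidirect_product A_dot B_dot \<sigma>\<^esub> z)
        = (x \<otimes>\<^bsub>semidirect_product A_circ B_circ \<tau>\<^esub> y) \<otimes>\<^bsub>semidirect_product A_dot B_dot \<sigma>\<^esub>
          inv\<^bsub>semidirect_product A_dot B_dot \<sigma>\<^esub> x \<otimes>\<^bsub>semidirect_product A_dot B_dot \<sigma>\<^esub>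
          (x \<otimes>\<^bsub>semidirect_product A_circ B_circ \<tau>\<^esub> z)"
      using a b
      by (simp add: xyz B.brace_compat
          inv_semidirect_product[OF A.add.is_group B.add.is_group \<sigma>])
  qed
qed

end
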